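(* The following hold for the Cantor fan $C$. 1. There is a continuous mapping $f:C\to C$ that is not a homeomorphism such that $(C,f)$ is chaotic in the sense of Knudsen but not in the sense of Devaney. 2. There is a homeomorphism $h:C\to C$ such that $(C,h)$ is chaotic in the sense of Knudsen but not in the sense of Devaney.
   Context: A Cantor fan is any continuum (non-empty compact connected metric space) homeomorphic to $\bigcup_{c\in K}A_c$, where $K\subseteq[0,1]$ is a Cantor set and, for each $c\in K$, $A_c$ is the convex segment in the plane from $(0,0)$ to $(c,-1)$; it is unique up to homeomorphism. A dynamical system is a pair $(X,f)$ where $(X,d)$ is a compact metric space and $f:X\to X$ is continuous. $(X,f)$ is transitive if for all non-empty open $U,V\subseteq X$ there is a non-negative integer $n$ with $f^n(U)\cap V\ne\emptyset$. $(X,f)$ has sensitive dependence on initial conditions if there is $\varepsilon>0$ such that for each $x\in X$ and each $\delta>0$ there are $y\in X$ with $d(x,y)<\delta$ and a positive integer $n$ with $d(f^n(x),f^n(y))>\varepsilon$ (for compact $X$ this does not depend on the choice of compatible metric). $\mathcal P(f)$ denotes the set of periodic points, i.e. points $p$ with $f^n(p)=p$ for some positive integer $n$. $(X,f)$ is chaotic in the sense of Knudsen if $\mathcal P(f)$ is dense in $X$ and $(X,f)$ has sensitive dependence on initial conditions. $(X,f)$ is chaotic in the sense of Devaney if it is transitive and $\mathcal P(f)$ is dense in $X$. *)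

theory Defs
  imports "HOL-Analysis.Analysis"
begin

text \<open>Metric spaces are given by a carrier set and a distance function, as in the library
  locale \<^locale>\<open>Metric_space\<close>. Self-maps are total functions of which only the values on the
  carrier matter.\<close>

subsection \<open>The Cantor fan\<close>

fun ternary_stage :: "nat \<Rightarrow> real set" where
  "ternary_stage 0 = {0..1}"
| "ternary_stage (Suc n) =
     (\<lambda>x. x / 3) ` ternary_stage n \<union> (\<lambda>x. (x + 2) / 3) ` ternary_stage n"

definition ternary_cantor_set :: "real set" where
  "ternary_cantor_set = (\<Inter>n. ternary_stage n)"

definition is_cantor_set :: "real set \<Rightarrow> bool" where
  "is_cantor_set K \<longleftrightarrow> K homeomorphic ternary_cantor_set"

definition fan_over :: "real set \<Rightarrow> (real \<times> real) set" where
  "fan_over K = (\<Union>c\<in>K. closed_segment (0, 0) (c, -1))"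

definition continuum :: "'a set \<Rightarrow> ('a \<Rightarrow> 'a \<Rightarrow> real) \<Rightarrow> bool" where
  "continuum X d \<longleftrightarrow>
     Metric_space X d \<and> X \<noteq> {} \<and>
     compact_space (Metric_space.mtopology X d) \<and>
     connected_space (Metric_space.mtopology X d)"

definition is_cantor_fan :: "'a set \<Rightarrow> ('a \<Rightarrow> 'a \<Rightarrow> real) \<Rightarrow> bool" where
  "is_cantor_fan X d \<longleftrightarrow>
     continuum X d \<and>
     (\<exists>K. K \<subseteq> {0..1} \<and> is_cantor_set K \<and>
        Metric_space.mtopology X d homeomorphic_space top_of_set (fan_over K))"

subsection \<open>Dynamical systems\<close>

definition dynamical_system :: "'a set \<Rightarrow> ('a \<Rightarrow> 'a \<Rightarrow> real) \<Rightarrow> ('a \<Rightarrow> 'a) \<Rightarrow> bool" where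
  "dynamical_system X d f \<longleftrightarrow>
     Metric_space X d \<and> compact_space (Metric_space.mtopology X d) \<and>
     continuous_map (Metric_space.mtopology X d) (Metric_space.mtopology X d) f"

definition transitive_system :: "'a set \<Rightarrow> ('a \<Rightarrow> 'a \<Rightarrow> real) \<Rightarrow> ('a \<Rightarrow> 'a) \<Rightarrow> bool" where
  "transitive_system X d f \<longleftrightarrow>
     (\<forall>U V. openin (Metric_space.mtopology X d) U \<and> U \<noteq> {} \<and>
            openin (Metric_space.mtopology X d) V \<and> V \<noteq> {} \<longrightarrow>
        (\<exists>n. (f ^^ n) ` U \<inter> V \<noteq> {}))"

definition sensitive_dependence :: "'a set \<Rightarrow> ('a \<Rightarrow> 'a \<Rightarrow> real) \<Rightarrow> ('a \<Rightarrow> 'a) \<Rightarrow> bool" where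
  "sensitive_dependence X d f \<longleftrightarrow>
     (\<exists>\<epsilon>>0. \<forall>x\<in>X. \<forall>\<delta>>0. \<exists>y\<in>X. d x y < \<delta> \<and>
        (\<exists>n>0. d ((f ^^ n) x) ((f ^^ n) y) > \<epsilon>))"

definition periodic_points :: "'a set \<Rightarrow> ('a \<Rightarrow> 'a) \<Rightarrow> 'a set" where
  "periodic_points X f = {p \<in> X. \<exists>n>0. (f ^^ n) p = p}"

definition dense_periodic_points :: "'a set \<Rightarrow> ('a \<Rightarrow> 'a \<Rightarrow> real) \<Rightarrow> ('a \<Rightarrow> 'a) \<Rightarrow> bool" where
  "dense_periodic_points X d f \<longleftrightarrow>
     Metric_space.mtopology X d closure_of periodic_points X f = X"

definition knudsen_chaotic :: "'a set \<Rightarrow> ('a \<Rightarrow> 'a \<Rightarrow> real) \<Rightarrow> ('a \<Rightarrow> 'a) \<Rightarrow> bool" where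
  "knudsen_chaotic X d f \<longleftrightarrow> dense_periodic_points X d f \<and> sensitive_dependence X d f"

definition devaney_chaotic :: "'a set \<Rightarrow> ('a \<Rightarrow> 'a \<Rightarrow> real) \<Rightarrow> ('a \<Rightarrow> 'a) \<Rightarrow> bool" where
  "devaney_chaotic X d f \<longleftrightarrow> transitive_system X d f \<and> dense_periodic_points X d f"

end

theory Submission
  imports Defs "HOL-Real_Asymp.Real_Asymp" "HOL-Library.Nat_Bijection"
begin

text \<open>
  A point of the fan has a branch, which is a point of the Cantor set, and a level in
  \<open>[0, 1]\<close>, with level \<open>0\<close> at the vertex. Branches can be labelled by pairs
  \<open>(b, x)\<close>, where \<open>b\<close> is a bit and \<open>x\<close> is a sequence of bits indexed by \<open>\<int>\<close> or by \<open>\<nat>\<close>.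
  The map keeps \<open>b\<close>, shifts \<open>x\<close>, and replaces the level \<open>t\<close> by \<open>sqrt t\<close> or by \<open>t\<^sup>2\<close>
  according to the symbol \<open>x 0\<close>. Since \<open>0\<close> is a fixed level, this passes to the fan. It has
  the required properties for the following reasons.

  \<^item> Square root and square are inverse to each other on \<open>[0, 1]\<close>, so the level after \<open>n\<close> steps
    is \<open>t powr (2 powr w)\<close>, where \<open>w\<close> counts the symbols read with signs. A periodic
    sequence with as many zeros as ones in its period therefore returns \<^emph>\<open>every\<close> level to
    itself. Each window of a sequence extends to such a balanced sequence, and the
    periodic points are dense (\<open>balanced_periodic_extension\<close>, \<open>periodic_points_dense\<close>).
  \<^item> Outside a window the sequence is free. Continuing it with zeros drives a level strictly
    between \<open>0\<close> and \<open>1\<close> down to \<open>0\<close>, and continuing it with ones drives it up to \<open>1\<close>. So every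
    nonempty open set contains two points that are, at one and the same time, close to the
    vertex and far from it, and the orbit of a third point cannot follow both
    (\<open>level_driven_to_both_ends\<close>, \<open>sensitive\<close>). In particular the vertex, although it is fixed,
    is a point of sensitivity.
  \<^item> The bit \<open>b\<close> never changes, so the two halves of the fan without the vertex are
    disjoint nonempty invariant open sets (\<open>not_transitive\<close>).

  With two-sided sequences the map is a homeomorphism. With one-sided sequences the shift
  forgets the symbol \<open>x 0\<close>, and on the level \<open>1\<close> nothing else records it, so the map is not
  injective. The one-sided system is a factor of the two-sided one, and the three arguments
  above pass to such factors, so they are carried out once, in the locale
  \<open>fan_factor\<close>, for an arbitrary factor of the two-sided model that keeps the level and, off
  the vertex, the bit \<open>b\<close>.
\<close>

section \<open>The two-sided symbolic model\<close>

definition model_step :: "bool \<times> (int \<Rightarrow> bool) \<times> real \<Rightarrow> bool \<times> (int \<Rightarrow> bool) \<times> real" where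
  "model_step = (\<lambda>(b, x, t). (b, \<lambda>i. x (i + 1), if x 0 then sqrt t else t\<^sup>2))"

definition cylinder :: "(bool \<times> (int \<Rightarrow> bool) \<times> real) set" where
  "cylinder = UNIV \<times> UNIV \<times> {0..1}"

text \<open>The exponent of the level after \<open>n\<close> steps is \<open>2 powr walk x n\<close>: a square root halves it and
  a square doubles it.\<close>

definition walk :: "(int \<Rightarrow> bool) \<Rightarrow> nat \<Rightarrow> real" where
  "walk x n = (\<Sum>i<n. if x (int i) then -1 else 1)"

lemma model_step_in_cylinder: "p \<in> cylinder \<Longrightarrow> model_step p \<in> cylinder"
proof -
  assume "p \<in> cylinder"
  then obtain b x t where p: "p = (b, x, t)" "0 \<le> t" "t \<le> 1"
    by (auto simp: cylinder_def)
  then show ?thesis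
    by (simp add: model_step_def cylinder_def power_le_one)
qed

lemma model_step_iterate:
  assumes "0 \<le> t"
  shows "(model_step ^^ n) (b, x, t) = (b, \<lambda>i. x (i + int n), t powr (2 powr walk x n))"
proof (induction n)
  case 0
  show ?case using assms by (simp add: walk_def)
next
  case (Suc n)
  define a where "a = walk x n"
  have root: "sqrt (t powr (2 powr a)) = t powr (2 powr (a - 1))"
    using assms by (simp flip: powr_half_sqrt add: powr_powr powr_diff)
  have square: "(t powr (2 powr a))\<^sup>2 = t powr (2 powr (a + 1))"
    using powr_add[of t "2 powr a" "2 powr a"] powr_add[of "2::real" a 1]
    by (simp add: power2_eq_square mult_2_right)
  have "walk x (Suc n) = (if x (int n) then a - 1 else a + 1)"
    by (simp add: walk_def a_def)
  moreover have "(\<lambda>i. x (i + 1 + int n)) = (\<lambda>i. x (i + int (Suc n)))"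
    by (rule ext, rule arg_cong[where f = x]) simp
  moreover have "(model_step ^^ Suc n) (b, x, t)
      = model_step (b, \<lambda>i. x (i + int n), t powr (2 powr a))"
    using Suc by (simp add: a_def)
  ultimately show ?case
    unfolding model_step_def by (simp only: prod.case root square) simp
qed

lemma model_step_continuous: "continuous_on cylinder model_step"
proof -
  have coordinate: "continuous_on UNIV (\<lambda>p::bool \<times> (int \<Rightarrow> bool) \<times> real. fst (snd p) i)" for i
    by (rule continuous_on_product_then_coordinatewise)
      (rule continuous_on_fst continuous_on_snd continuous_on_id)+
  have symbol: "continuous_on UNIV (\<lambda>p::bool \<times> (int \<Rightarrow> bool) \<times> real. g (fst (snd p) 0) :: real)" for g
    by (rule continuous_on_compose2[OF Topological_Spaces.continuous_on_discrete[of UNIV g] coordinate]) simp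
  have level: "continuous_on UNIV (\<lambda>p::bool \<times> (int \<Rightarrow> bool) \<times> real. snd (snd p))"
    by (rule continuous_on_snd continuous_on_id)+
  \<comment> \<open>Continuity of the case distinction is that of a sum weighted by the symbol read, which
    takes values in a discrete space.\<close>
  have eq: "model_step = (\<lambda>p. (fst p, \<lambda>i. fst (snd p) (i + 1),
      of_bool (fst (snd p) 0) * sqrt (snd (snd p)) + of_bool (\<not> fst (snd p) 0) * (snd (snd p))\<^sup>2))"
    by (auto simp: model_step_def fun_eq_iff)
  have "continuous_on UNIV model_step"
    unfolding eq
    by (rule continuous_on_Pair continuous_on_fst continuous_on_id continuous_on_add
        continuous_on_mult symbol continuous_on_real_sqrt continuous_on_power level
        continuous_on_coordinatewise_then_product coordinate)+
  then show ?thesis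
    using continuous_on_subset by blast
qed

lemma compact_UNIV_bool_sequences: "compact (UNIV :: ('i \<Rightarrow> bool) set)"
proof -
  have "compact_space (euclidean :: bool topology)"
    by (simp add: compact_space_def finite_imp_compact)
  then have "compact_space (product_topology (\<lambda>i::'i. euclidean :: bool topology) UNIV)"
    by (simp add: compact_space_product_topology)
  then show ?thesis
    by (simp add: euclidean_product_topology compact_space_def)
qed

lemma compact_cylinder: "compact cylinder"
  unfolding cylinder_def by (intro compact_Times compact_UNIV_bool_sequences compact_Icc finite_imp_compact) simp

text \<open>A basic neighbourhood restricts only finitely many symbols, and its level can be moved
  off the ends \<open>0\<close> and \<open>1\<close>, where the dynamics on levels stands still.\<close>

lemma cylinder_basic_neighbourhood:
  fixes t :: real and x :: "int \<Rightarrow> bool"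
  assumes "open U" "(b, x, t) \<in> U" "0 \<le> t" "t \<le> 1"
  obtains N :: nat and s where "0 < s" "s < 1"
    "\<And>y. (\<And>i. \<bar>i\<bar> \<le> int N \<Longrightarrow> y i = x i) \<Longrightarrow> (b, y, s) \<in> U"
proof -
  obtain A B where AB: "open A" "open B" "b \<in> A" "(x, t) \<in> B" "A \<times> B \<subseteq> U"
    using open_prod_elim[OF assms(1,2)] by (metis mem_Sigma_iff)
  obtain V W where VW: "open V" "open W" "x \<in> V" "t \<in> W" "V \<times> W \<subseteq> B"
    using open_prod_elim[OF AB(2,4)] by (metis mem_Sigma_iff)
  obtain X where X: "x \<in> Pi\<^sub>E UNIV X" "finite {i. X i \<noteq> UNIV}" "Pi\<^sub>E UNIV X \<subseteq> V"
    using product_topology_open_contains_basis[of "\<lambda>i. euclidean" UNIV V x] VW(1,3)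
    by (auto simp: open_fun_def)
  obtain N :: nat where N: "\<And>i. X i \<noteq> UNIV \<Longrightarrow> \<bar>i\<bar> \<le> int N"
  proof -
    have "finite ((\<lambda>i. nat \<bar>i\<bar>) ` {i. X i \<noteq> UNIV})" using X(2) by blast
    then obtain N where "\<forall>k\<in>(\<lambda>i. nat \<bar>i\<bar>) ` {i. X i \<noteq> UNIV}. k \<le> N"
      using finite_nat_set_iff_bounded_le by blast
    then show thesis by (intro that[of N]) force
  qed
  obtain e where e: "e > 0" "\<And>s. \<bar>s - t\<bar> < e \<Longrightarrow> s \<in> W"
    using VW(2,4) by (auto simp: open_dist dist_real_def)
  \<comment> \<open>Move \<open>t\<close> by a small fraction of the way towards the midpoint of the interval.\<close>
  define m where "m = min e 1 / 2"
  have m: "0 < m" "m < 1" "m < e" using e(1) by (auto simp: m_def)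
  define s where "s = t + m * (1 / 2 - t)"
  have s: "s = (1 - m) * t + m / 2" by (simp add: s_def algebra_simps)
  have "0 \<le> (1 - m) * t" using m assms(3) by simp
  then have "0 < s" using s m by linarith
  moreover have "(1 - m) * t \<le> 1 - m"
    using m assms(4) by (simp add: mult_left_le)
  then have "s < 1" using s m by linarith
  moreover have "s \<in> W"
  proof (rule e(2))
    have "\<bar>m * (1 / 2 - t)\<bar> \<le> m * 1"
      unfolding abs_mult using m assms(3,4) by (intro mult_mono) auto
    then show "\<bar>s - t\<bar> < e" using m by (simp add: s_def)
  qed
  moreover have "(b, y, s) \<in> U" if "\<And>i. \<bar>i\<bar> \<le> int N \<Longrightarrow> y i = x i" for y
  proof -
    have "y i \<in> X i" for i
      using N[of i] that[of i] X(1) by (cases "X i = UNIV") (auto simp: PiE_iff)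
    then have "y \<in> V" using X(3) by (auto simp: PiE_iff)
    then show ?thesis using AB VW \<open>s \<in> W\<close> by blast
  qed
  ultimately show thesis using that by blast
qed

text \<open>Repeat the window of length \<open>M = 2 N + 1\<close> forever, negating all symbols in every other copy.
  Two consecutive copies form a period, and their contributions to the walk cancel.\<close>

lemma balanced_periodic_extension:
  fixes x :: "int \<Rightarrow> bool" and N :: nat
  obtains y n where "n > 0" "\<And>i. \<bar>i\<bar> \<le> int N \<Longrightarrow> y i = x i"
    "\<And>i. y (i + int n) = y i" "walk y n = 0"
proof -
  define M where "M = 2 * N + 1"
  define y where "y i = (x ((i + int N) mod int M - int N) \<noteq> odd ((i + int N) div int M))" for i
  have flip: "y (i + int M) = (\<not> y i)" for i
  proof -
    have "i + int M + int N = (i + int N) + int M * 1" by simp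
    then have "(i + int M + int N) mod int M = (i + int N) mod int M"
      "(i + int M + int N) div int M = (i + int N) div int M + 1"
      by (simp_all only: mod_mult_self2) (subst div_mult_self2, auto simp: M_def)
    then show ?thesis by (auto simp: y_def)
  qed
  have "y i = x i" if "\<bar>i\<bar> \<le> int N" for i
    using that by (auto simp: y_def M_def)
  moreover have "y (i + int (2 * M)) = y i" for i
    using flip[of i] flip[of "i + int M"] by (simp add: algebra_simps)
  moreover have "walk y (2 * M) = 0"
  proof -
    have split: "(\<Sum>i<2 * M. g i) = (\<Sum>i<M. g i) + (\<Sum>i<M. g (i + M))" for g :: "nat \<Rightarrow> real"
      using sum.nat_group[of g M 2] by (simp add: numeral_2_eq_2 mult_2 atLeast0LessThan[symmetric]
            sum.shift_bounds_nat_ivl[symmetric] sum.atLeastLessThan_concat)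
    have "walk y (2 * M) = (\<Sum>i<M. (if y (int i) then -1 else 1) + (if y (int i) then 1 else -1))"
      unfolding walk_def split using flip
      by (auto simp: sum.distrib[symmetric] algebra_simps intro!: sum.cong)
    also have "\<dots> = 0" by (intro sum.neutral) auto
    finally show ?thesis .
  qed
  ultimately show thesis by (intro that[of "2 * M" y]) (auto simp: M_def)
qed

text \<open>Outside the window the symbol \<open>v\<close> makes the walk drift linearly in the direction chosen
  by \<open>v\<close>.\<close>

lemma eventually_constant_extension_walk:
  fixes x :: "int \<Rightarrow> bool" and N :: nat and v :: bool
  defines "y \<equiv> \<lambda>i. if i \<le> int N then x i else v"
  shows "walk y (Suc N + k) = walk x (Suc N) + (if v then - real k else real k)"
proof (induction k)
  case 0
  show ?case unfolding walk_def by (auto simp: y_def intro!: sum.cong)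
next
  case (Suc k)
  then show ?case by (auto simp: walk_def y_def)
qed

text \<open>The two continuations must agree with \<open>x\<close> on the window but be far apart at a
  common time \<open>n\<close>. Both bounds hold for all large \<open>n\<close>, so such an \<open>n\<close> exists.\<close>

lemma level_driven_to_both_ends:
  fixes x :: "int \<Rightarrow> bool" and N :: nat
  assumes "0 < s" "s < 1"
  obtains y z n where "n > 0" "\<And>i. \<bar>i\<bar> \<le> int N \<Longrightarrow> y i = x i" "\<And>i. \<bar>i\<bar> \<le> int N \<Longrightarrow> z i = x i"
    "s powr (2 powr walk y n) \<le> 1 / 4" "1 / 2 \<le> s powr (2 powr walk z n)"
proof -
  define Y where "Y v = (\<lambda>i. if i \<le> int N then x i else v)" for v
  define w where "w = walk x (Suc N)"
  have "(\<lambda>k. s powr (2 powr (w + real k))) \<longlonglongrightarrow> 0"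
    using assms by real_asymp
  then have 1: "\<forall>\<^sub>F k in sequentially. s powr (2 powr (w + real k)) < 1 / 4"
    by (rule order_tendstoD) simp
  have "(\<lambda>k. s powr (2 powr (w - real k))) \<longlonglongrightarrow> 1"
    using assms by real_asymp
  then have 2: "\<forall>\<^sub>F k in sequentially. 1 / 2 < s powr (2 powr (w - real k))"
    by (rule order_tendstoD) simp
  obtain k where k: "s powr (2 powr (w + real k)) < 1 / 4" "1 / 2 < s powr (2 powr (w - real k))"
    using eventually_conj[OF 1 2] by (auto simp: eventually_sequentially)
  show thesis
    by (rule that[of "Suc N + k" "Y False" "Y True"])
      (use k in \<open>auto simp: Y_def w_def eventually_constant_extension_walk simp del: add_Suc\<close>)
qed

section \<open>Addresses in the ternary Cantor set\<close>

text \<open>The point of the ternary Cantor set with ternary digits \<open>0\<close> and \<open>2\<close>, the \<open>n\<close>-th digit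
  being \<open>2\<close> if \<open>c n\<close> holds. A sequence of bits is thereby an address in the Cantor set.\<close>

definition ternary_point :: "(nat \<Rightarrow> bool) \<Rightarrow> real" where
  "ternary_point c = (\<Sum>n. 2 * of_bool (c n) / 3 ^ Suc n)"

lemma ternary_majorant: "(\<lambda>n. 2 / 3 ^ Suc n :: real) sums 1"
proof -
  have "(\<lambda>n. 2 / 3 * (1 / 3) ^ n :: real) sums (2 / 3 * (1 / (1 - 1 / 3)))"
    by (intro sums_mult geometric_sums) simp
  then show ?thesis by (simp add: power_divide)
qed

lemma summable_ternary: "summable (\<lambda>n. 2 * of_bool (c n) / 3 ^ Suc n :: real)"
  by (rule summable_comparison_test'[OF sums_summable[OF ternary_majorant], of 0]) auto

lemma ternary_point_bounds: "ternary_point c \<in> {0..1}"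
proof -
  have "ternary_point c \<le> (\<Sum>n. 2 / 3 ^ Suc n)"
    unfolding ternary_point_def
    by (intro suminf_le summable_ternary sums_summable[OF ternary_majorant]) auto
  moreover have "0 \<le> ternary_point c"
    unfolding ternary_point_def by (intro suminf_nonneg summable_ternary) simp
  ultimately show ?thesis
    using sums_unique[OF ternary_majorant] by simp
qed

text \<open>The self-similarity of the Cantor set: the first digit selects one of the two contractions
  by which the stages are built. The injectivity and the range of the address map rest on it.\<close>

lemma ternary_point_unfold:
  "ternary_point c = (if c 0 then (ternary_point (c \<circ> Suc) + 2) / 3 else ternary_point (c \<circ> Suc) / 3)"
proof -
  have "ternary_point c = (\<Sum>n. 2 * of_bool (c (Suc n)) / 3 ^ Suc (Suc n)) + 2 * of_bool (c 0) / 3"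
    unfolding ternary_point_def using suminf_split_head[OF summable_ternary[of c]] by simp
  also have "(\<Sum>n. 2 * of_bool (c (Suc n)) / 3 ^ Suc (Suc n)) = ternary_point (c \<circ> Suc) / 3"
    unfolding ternary_point_def
    using suminf_divide[OF summable_ternary[of "c \<circ> Suc"], of 3] by (simp add: mult.commute)
  finally show ?thesis by (simp add: add_divide_distrib)
qed

text \<open>The images of \<open>[0, 1]\<close> under the two contractions are disjoint, so a point determines the
  first digit of its address, and then the address of its preimage under that contraction.\<close>

lemma ternary_point_inj: "inj ternary_point"
proof (rule injI)
  fix c c' :: "nat \<Rightarrow> bool"
  have "c n = c' n" if "ternary_point c = ternary_point c'" for n
    using that
  proof (induction n arbitrary: c c')
    case 0
    then show ?case
      using ternary_point_unfold[of c] ternary_point_unfold[of c']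
        ternary_point_bounds[of "c \<circ> Suc"] ternary_point_bounds[of "c' \<circ> Suc"]
      by (auto split: if_splits)
  next
    case (Suc n)
    have "ternary_point (c \<circ> Suc) = ternary_point (c' \<circ> Suc)"
      using Suc.prems ternary_point_unfold[of c] ternary_point_unfold[of c']
        ternary_point_bounds[of "c \<circ> Suc"] ternary_point_bounds[of "c' \<circ> Suc"]
      by (auto split: if_splits)
    from Suc.IH[OF this] show ?case by simp
  qed
  then show "ternary_point c = ternary_point c' \<Longrightarrow> c = c'" by auto
qed

lemma ternary_point_continuous: "continuous_on UNIV ternary_point"
proof (rule uniform_limit_theorem)
  show "uniform_limit UNIV (\<lambda>n c. \<Sum>i<n. 2 * of_bool (c i) / 3 ^ Suc i) ternary_point sequentially"
    unfolding ternary_point_def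
    by (rule Weierstrass_m_test[OF _ sums_summable[OF ternary_majorant]]) auto
  have "continuous_on UNIV (\<lambda>c::nat \<Rightarrow> bool. 2 * of_bool (c i) / 3 ^ Suc i :: real)" for i
    by (rule continuous_on_compose2[OF Topological_Spaces.continuous_on_discrete
            [of UNIV "\<lambda>v. 2 * of_bool v / 3 ^ Suc i"] continuous_on_product_coordinates]) simp
  then show "\<forall>\<^sub>F n in sequentially. continuous_on UNIV
      (\<lambda>c::nat \<Rightarrow> bool. \<Sum>i<n. 2 * of_bool (c i) / 3 ^ Suc i :: real)"
    by (intro always_eventually allI continuous_on_sum)
qed simp

lemma ternary_point_in_stage: "ternary_point c \<in> ternary_stage n"
proof (induction n arbitrary: c)
  case 0
  then show ?case using ternary_point_bounds by simp
next
  case (Suc n)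
  then show ?case
    by (subst ternary_point_unfold) auto
qed

text \<open>Points of the \<open>n\<close>-th stage need not have an address, but the contractions bring them
  within \<open>1 / 3 ^ n\<close> of one that has.\<close>

lemma ternary_stage_near_points:
  "x \<in> ternary_stage n \<Longrightarrow> \<exists>c. \<bar>x - ternary_point c\<bar> \<le> 1 / 3 ^ n"
proof (induction n arbitrary: x)
  case 0
  then show ?case
    using ternary_point_bounds[of "\<lambda>_. False"] by (intro exI[of _ "\<lambda>_. False"]) auto
next
  case (Suc n)
  then obtain y v where y: "y \<in> ternary_stage n" "x = (if v then (y + 2) / 3 else y / 3)"
  proof -
    have "\<exists>y\<in>ternary_stage n. x = (if False then (y + 2) / 3 else y / 3) \<or> x = (if True then (y + 2) / 3 else y / 3)"
      using Suc.prems by auto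
    then show thesis using that by blast
  qed
  obtain c where c: "\<bar>y - ternary_point c\<bar> \<le> 1 / 3 ^ n"
    using Suc.IH[OF y(1)] by blast
  have "x - ternary_point (case_nat v c) = (y - ternary_point c) / 3"
    using y(2) by (subst ternary_point_unfold) (auto simp: o_def field_simps)
  then show ?case
    using c by (intro exI[of _ "case_nat v c"]) simp
qed

text \<open>A point of all stages is a limit of points with an address, and these form a compact set.\<close>

lemma range_ternary_point: "range ternary_point = ternary_cantor_set"
proof
  show "range ternary_point \<subseteq> ternary_cantor_set"
    using ternary_point_in_stage by (auto simp: ternary_cantor_set_def)
  have "closed (range ternary_point)"
    using compact_continuous_image[OF ternary_point_continuous compact_UNIV_bool_sequences]
    by (rule compact_imp_closed)
  moreover have "x \<in> closure (range ternary_point)" if x: "x \<in> ternary_cantor_set" for x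
    unfolding closure_approachable
  proof (intro allI impI)
    fix e :: real assume "e > 0"
    then obtain n where n: "(1 / 3) ^ n < e"
      using real_arch_pow_inv[of e "1 / 3"] by auto
    obtain c where "\<bar>x - ternary_point c\<bar> \<le> 1 / 3 ^ n"
      using ternary_stage_near_points[of x n] x[unfolded ternary_cantor_set_def] by blast
    then show "\<exists>y\<in>range ternary_point. dist y x < e"
      using n by (intro bexI[of _ "ternary_point c"]) (auto simp: dist_real_def power_divide)
  qed
  ultimately show "ternary_cantor_set \<subseteq> range ternary_point"
    by auto
qed

section \<open>Chaos in factors of the model\<close>

text \<open>A system that is a factor of the symbolic model through a map which remembers the level
  and, off the vertex, the invariant bit. It may forget symbols of the sequence.\<close>

locale fan_factor = Metric_space C d for C :: "'a set" and d +
  fixes Q :: "bool \<times> (int \<Rightarrow> bool) \<times> real \<Rightarrow> 'a" and f :: "'a \<Rightarrow> 'a"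
  assumes Q_continuous: "continuous_map (top_of_set cylinder) mtopology Q"
    and Q_onto: "Q ` cylinder = C"
    and Q_level: "\<lbrakk>p \<in> cylinder; q \<in> cylinder; Q p = Q q\<rbrakk> \<Longrightarrow> snd (snd p) = snd (snd q)"
    and Q_branch: "\<lbrakk>p \<in> cylinder; q \<in> cylinder; Q p = Q q; snd (snd p) > 0\<rbrakk> \<Longrightarrow> fst p = fst q"
    and semiconjugacy: "p \<in> cylinder \<Longrightarrow> f (Q p) = Q (model_step p)"
begin

lemma Q_in: "p \<in> cylinder \<Longrightarrow> Q p \<in> C"
  using Q_onto by blast

lemma iterate_Q:
  assumes "p \<in> cylinder"
  shows "(model_step ^^ n) p \<in> cylinder" "(f ^^ n) (Q p) = Q ((model_step ^^ n) p)"
  by (induction n) (simp_all add: assms model_step_in_cylinder semiconjugacy)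

lemma iterate_Q_triple:
  assumes "0 \<le> t" "t \<le> 1"
  shows "(f ^^ n) (Q (b, x, t)) = Q (b, \<lambda>i. x (i + int n), t powr (2 powr walk x n))"
    and "(b, \<lambda>i. x (i + int n), t powr (2 powr walk x n)) \<in> cylinder"
  using iterate_Q[of "(b, x, t)" n] assms by (simp_all add: cylinder_def model_step_iterate)

lemma compact_space_C: "compact_space mtopology"
proof -
  have "compactin (top_of_set cylinder) cylinder"
    by (simp add: compactin_subtopology compact_cylinder)
  then have "compactin mtopology (Q ` cylinder)"
    using Q_continuous image_compactin by blast
  then show ?thesis
    by (simp add: Q_onto compact_space_def)
qed

text \<open>A continuous map from a compact space onto a Hausdorff space is a quotient map, so
  continuity can be tested on the model.\<close>

lemma f_continuous: "continuous_map mtopology mtopology f"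
proof (rule continuous_compose_quotient_map)
  show "quotient_map (top_of_set cylinder) mtopology Q"
    by (rule T1_Spaces.continuous_imp_quotient_map[OF Q_continuous _ Hausdorff_space_mtopology])
      (simp_all add: Q_onto compact_space_subtopology compact_cylinder)
  have "continuous_map (top_of_set cylinder) (top_of_set cylinder) model_step"
    using model_step_continuous model_step_in_cylinder
    by (auto simp: continuous_map_in_subtopology)
  then have "continuous_map (top_of_set cylinder) mtopology (Q \<circ> model_step)"
    using Q_continuous continuous_map_compose by blast
  then show "continuous_map (top_of_set cylinder) mtopology (f \<circ> Q)"
    by (rule continuous_map_eq) (simp add: semiconjugacy)
qed

text \<open>Every ball contains the images of all points with one fixed level strictly between \<open>0\<close> and
  \<open>1\<close> and a prescribed finite window of symbols. This is all that density of
  periodic points and sensitivity use about small neighbourhoods, and it covers the vertex too.\<close>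

lemma ball_contains_window:
  assumes "z \<in> C" "r > 0"
  obtains b x s and N :: nat where "0 < s" "s < 1"
    "\<And>y. (\<And>i. \<bar>i\<bar> \<le> int N \<Longrightarrow> y i = x i) \<Longrightarrow> Q (b, y, s) \<in> mball z r"
proof -
  have "openin (top_of_set cylinder) {p \<in> topspace (top_of_set cylinder). Q p \<in> mball z r}"
    using Q_continuous openin_mball by (rule openin_continuous_map_preimage)
  then obtain U where U: "open U" "{p \<in> cylinder. Q p \<in> mball z r} = cylinder \<inter> U"
    by (auto simp: openin_open)
  obtain b x t where p: "(b, x, t) \<in> cylinder" "z = Q (b, x, t)"
    using assms(1) Q_onto by (metis imageE prod_cases3)
  have "(b, x, t) \<in> {p \<in> cylinder. Q p \<in> mball z r}"
    using p assms by simp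
  then have "(b, x, t) \<in> U"
    unfolding U(2) by blast
  moreover have "0 \<le> t" "t \<le> 1"
    using p(1) by (auto simp: cylinder_def)
  ultimately obtain N s where N: "0 < s" "s < 1"
    "\<And>y. (\<And>i. \<bar>i\<bar> \<le> int N \<Longrightarrow> y i = x i) \<Longrightarrow> (b, y, s) \<in> U"
    using cylinder_basic_neighbourhood[OF U(1)] by metis
  have "(b, y, s) \<in> cylinder" for y
    using N(1,2) by (simp add: cylinder_def)
  then show thesis
    using N U(2) by (intro that[of s N x b]) blast+
qed

lemma periodic_points_dense: "dense_periodic_points C d f"
proof -
  have "\<exists>p\<in>periodic_points C f. p \<in> mball z r" if zr: "z \<in> C" "r > 0" for z r
  proof -
    obtain b x s N where N: "0 < s" "s < 1"
      "\<And>y. (\<And>i. \<bar>i\<bar> \<le> int N \<Longrightarrow> y i = x i) \<Longrightarrow> Q (b, y, s) \<in> mball z r"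
      using ball_contains_window[OF zr] by metis
    obtain y n where y: "n > 0" "\<And>i. \<bar>i\<bar> \<le> int N \<Longrightarrow> y i = x i"
      "\<And>i. y (i + int n) = y i" "walk y n = 0"
      using balanced_periodic_extension[of N x] by metis
    have "(f ^^ n) (Q (b, y, s)) = Q (b, y, s)"
      using iterate_Q_triple(1)[of s n b y] N(1,2) y by simp
    moreover have "Q (b, y, s) \<in> mball z r"
      using N(3) y(2) by blast
    ultimately show ?thesis
      using y(1) unfolding periodic_points_def by (auto intro!: bexI[of _ "Q (b, y, s)"])
  qed
  then show ?thesis
    unfolding dense_periodic_points_def metric_closure_of by auto
qed

lemma closed_image_Q:
  assumes "closed A"
  shows "closedin mtopology (Q ` (cylinder \<inter> A))"
proof -
  have "compactin (top_of_set cylinder) (cylinder \<inter> A)"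
    using compact_cylinder assms by (simp add: compactin_subtopology compact_Int_closed)
  then show ?thesis
    using Q_continuous image_compactin compactin_imp_closedin Hausdorff_space_mtopology by blast
qed

lemma sensitive: "sensitive_dependence C d f"
proof -
  define A where "A = Q ` (cylinder \<inter> {p. snd (snd p) \<le> 1 / 4})"
  define B where "B = Q ` (cylinder \<inter> {p. 1 / 2 \<le> snd (snd p)})"
  have level: "continuous_on UNIV (\<lambda>p::bool \<times> (int \<Rightarrow> bool) \<times> real. snd (snd p))"
    by (rule continuous_on_snd continuous_on_id)+
  have "closedin mtopology A"
    unfolding A_def by (intro closed_image_Q closed_Collect_le level continuous_on_const)
  moreover have "closedin mtopology B"
    unfolding B_def by (intro closed_image_Q closed_Collect_le level continuous_on_const)
  moreover have "A \<inter> B = {}"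
  proof -
    have False if "p \<in> cylinder" "q \<in> cylinder" "Q p = Q q" "snd (snd p) \<le> 1 / 4" "1 / 2 \<le> snd (snd q)" for p q
      using Q_level[OF that(1-3)] that(4,5) by simp
    then show ?thesis by (auto simp: A_def B_def)
  qed
  \<comment> \<open>A Lebesgue number of the cover by the complements of \<open>A\<close> and \<open>B\<close>: no ball of this
    radius meets both sets.\<close>
  ultimately obtain e where e: "e > 0" "\<And>z. z \<in> C \<Longrightarrow> mball z e \<inter> A = {} \<or> mball z e \<inter> B = {}"
  proof -
    assume cl: "closedin mtopology A" "closedin mtopology B" and dis: "A \<inter> B = {}"
      and th: "\<And>e. \<lbrakk>e > 0; \<And>z. z \<in> C \<Longrightarrow> mball z e \<inter> A = {} \<or> mball z e \<inter> B = {}\<rbrakk> \<Longrightarrow> thesis"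
    have "\<exists>e>0. \<forall>z\<in>C. \<exists>U\<in>{C - A, C - B}. mball z e \<subseteq> U"
      using compact_space_C dis openin_diff[OF openin_topspace cl(1)] openin_diff[OF openin_topspace cl(2)]
      by (intro lebesgue_number) (auto simp: compact_space_def)
    then show thesis using th by blast
  qed
  show ?thesis
    unfolding sensitive_dependence_def
  proof (intro exI[of _ "e / 2"] conjI ballI allI impI)
    show "e / 2 > 0" using e(1) by simp
    fix z and \<delta> :: real assume z: "z \<in> C" and "\<delta> > 0"
    then obtain b x s N where N: "0 < s" "s < 1"
      "\<And>y. (\<And>i. \<bar>i\<bar> \<le> int N \<Longrightarrow> y i = x i) \<Longrightarrow> Q (b, y, s) \<in> mball z \<delta>"
      using ball_contains_window by metis
    obtain u v n where uv: "n > 0" "\<And>i. \<bar>i\<bar> \<le> int N \<Longrightarrow> u i = x i" "\<And>i. \<bar>i\<bar> \<le> int N \<Longrightarrow> v i = x i"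
      "s powr (2 powr walk u n) \<le> 1 / 4" "1 / 2 \<le> s powr (2 powr walk v n)"
      using level_driven_to_both_ends[OF N(1,2), of N x] by metis
    \<comment> \<open>At time \<open>n\<close> one neighbour of \<open>z\<close> is in \<open>A\<close> and another is in \<open>B\<close>, so one of them is at
      distance at least \<open>e\<close> from the orbit of \<open>z\<close>.\<close>
    have "(f ^^ n) (Q (b, u, s)) \<in> A" "(f ^^ n) (Q (b, v, s)) \<in> B"
      using iterate_Q_triple[where t = s and n = n and b = b] N(1,2) uv(4,5) by (auto simp: A_def B_def)
    moreover have "A \<subseteq> C" "B \<subseteq> C" using Q_in by (auto simp: A_def B_def)
    moreover have fz: "(f ^^ n) z \<in> C"
      using z iterate_Q Q_onto Q_in by (metis imageE)
    ultimately have "d ((f ^^ n) z) ((f ^^ n) (Q (b, u, s))) \<ge> e \<or> d ((f ^^ n) z) ((f ^^ n) (Q (b, v, s))) \<ge> e"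
      using e(2)[OF fz] in_mball[of _ "(f ^^ n) z" e] by (meson disjoint_iff not_le subsetD)
    moreover have "Q (b, u, s) \<in> mball z \<delta>" "Q (b, v, s) \<in> mball z \<delta>"
      using N(3) uv(2,3) by blast+
    ultimately obtain y where "y \<in> mball z \<delta>" "d ((f ^^ n) z) ((f ^^ n) y) \<ge> e"
      by blast
    then show "\<exists>y\<in>C. d z y < \<delta> \<and> (\<exists>n>0. d ((f ^^ n) z) ((f ^^ n) y) > e / 2)"
      using uv(1) e(1) by (intro bexI[of _ y] conjI exI[of _ n]) auto
  qed
qed

lemma not_transitive: "\<not> transitive_system C d f"
proof
  assume trans: "transitive_system C d f"
  \<comment> \<open>The half of the fan with bit \<open>b\<close>, without the vertex: its complement is the image of a
    compact set and contains the vertex, which belongs to all branches.\<close>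
  define U where "U b = C - Q ` (cylinder \<inter> {p. fst p = (\<not> b)})" for b
  have "closed {p::bool \<times> (int \<Rightarrow> bool) \<times> real. fst p = (\<not> b)}" for b
    using closed_vimage_fst[OF closed_singleton[of "\<not> b"]] by (simp add: vimage_def)
  then have "openin mtopology (U b)" for b
    unfolding U_def using openin_diff[OF openin_topspace closed_image_Q] by simp
  moreover have "U b \<noteq> {}" for b
  proof -
    define p :: "bool \<times> (int \<Rightarrow> bool) \<times> real" where "p = (b, \<lambda>_. False, 1)"
    have p: "p \<in> cylinder" "snd (snd p) > 0" "fst p = b" by (auto simp: p_def cylinder_def)
    have "Q p \<noteq> Q q" if "q \<in> cylinder" "fst q = (\<not> b)" for q
      using Q_branch[OF p(1) that(1) _ p(2)] p(3) that(2) by auto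
    then have "Q p \<in> U b"
      using Q_in[OF p(1)] unfolding U_def by blast
    then show ?thesis by blast
  qed
  ultimately obtain n where "(f ^^ n) ` U True \<inter> U False \<noteq> {}"
    using trans unfolding transitive_system_def by metis
  then obtain z where z: "z \<in> U True" "(f ^^ n) z \<in> U False" by blast
  then obtain b x t where p: "z = Q (b, x, t)" "(b, x, t) \<in> cylinder"
    using Q_onto unfolding U_def by (metis DiffD1 imageE prod_cases3)
  then have "b" using z(1) by (auto simp: U_def)
  then have "(f ^^ n) z \<in> Q ` (cylinder \<inter> {p. fst p = (\<not> False)})"
    using p iterate_Q_triple[where t = t and n = n and b = b and x = x] by (auto simp: cylinder_def)
  then show False using z(2) by (auto simp: U_def)
qed

lemma chaotic_in_Knudsen_not_Devaney_sense:
  "dynamical_system C d f" "knudsen_chaotic C d f" "\<not> devaney_chaotic C d f"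
  using Metric_space_axioms compact_space_C f_continuous periodic_points_dense sensitive not_transitive
  by (auto simp: dynamical_system_def knudsen_chaotic_def devaney_chaotic_def)

end

section \<open>The one-sided and the two-sided map on the fan\<close>

text \<open>The fan as the product of the Cantor space of one-sided sequences and the interval, with the
  level \<open>0\<close> collapsed to one point.\<close>

locale fan_coordinates = Metric_space C d for C :: "'a set" and d +
  fixes G :: "(nat \<Rightarrow> bool) \<times> real \<Rightarrow> 'a"
  assumes G_continuous: "continuous_map (top_of_set (UNIV \<times> {0..1})) mtopology G"
    and G_onto: "G ` (UNIV \<times> {0..1}) = C"
    and G_eq: "\<lbrakk>t \<in> {0..1}; t' \<in> {0..1}\<rbrakk> \<Longrightarrow>
      G (c, t) = G (c', t') \<longleftrightarrow> t = t' \<and> (t = 0 \<or> c = c')"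
begin

text \<open>The branch of a point of the model records the bit \<open>b\<close> and the symbols of \<open>x\<close> at the
  positions enumerated by \<open>e\<close>. With \<open>e = int\<close> this is the nonnegative half of the sequence, and
  with a bijection \<open>e\<close> it is the whole sequence.\<close>

definition reading :: "(nat \<Rightarrow> int) \<Rightarrow> bool \<times> (int \<Rightarrow> bool) \<times> real \<Rightarrow> 'a" where
  "reading e = (\<lambda>(b, x, t). G (case_nat b (x \<circ> e), t))"

text \<open>The choice of a preimage does not matter as soon as the recorded positions contain \<open>0\<close>, so
  that the step on levels is known, and are closed under successor, so that the shift is.\<close>

definition fan_map :: "(nat \<Rightarrow> int) \<Rightarrow> 'a \<Rightarrow> 'a" where
  "fan_map e z = reading e (model_step (inv_into cylinder (reading e) z))"

lemma reading_eq:
  assumes "(b, x, t) \<in> cylinder" "(b', x', t') \<in> cylinder"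
  shows "reading e (b, x, t) = reading e (b', x', t') \<longleftrightarrow>
    t = t' \<and> (t = 0 \<or> b = b' \<and> x \<circ> e = x' \<circ> e)"
proof -
  have "case_nat b (x \<circ> e) = case_nat b' (x' \<circ> e) \<longleftrightarrow> b = b' \<and> x \<circ> e = x' \<circ> e"
  proof
    assume eq: "case_nat b (x \<circ> e) = case_nat b' (x' \<circ> e)"
    have "b = b'" using fun_cong[OF eq, of 0] by simp
    moreover have "(x \<circ> e) n = (x' \<circ> e) n" for n using fun_cong[OF eq, of "Suc n"] by simp
    ultimately show "b = b' \<and> x \<circ> e = x' \<circ> e" by blast
  qed auto
  then show ?thesis
    using assms G_eq by (simp add: reading_def cylinder_def)
qed

lemma reading_onto:
  assumes "inj e"
  shows "reading e ` cylinder = C"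
proof -
  have "G (c, t) \<in> reading e ` cylinder" if "t \<in> {0..1}" for c t
  proof -
    have "case_nat (c 0) ((\<lambda>i. c (Suc (inv e i))) \<circ> e) = c"
      using assms by (auto simp: fun_eq_iff split: nat.split)
    then have "reading e (c 0, \<lambda>i. c (Suc (inv e i)), t) = G (c, t)"
      by (simp add: reading_def)
    then show ?thesis
      using that by (intro image_eqI[of _ _ "(c 0, \<lambda>i. c (Suc (inv e i)), t)"]) (auto simp: cylinder_def)
  qed
  moreover have "reading e p \<in> C" if "p \<in> cylinder" for p
    using that G_onto by (auto simp: reading_def cylinder_def)
  ultimately show ?thesis
    using G_onto by auto
qed

lemma reading_continuous: "continuous_map (top_of_set cylinder) mtopology (reading e)"
proof -
  have coordinate: "continuous_on UNIV (\<lambda>p::bool \<times> (int \<Rightarrow> bool) \<times> real. fst (snd p) i)" for i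
    by (rule continuous_on_product_then_coordinatewise)
      (rule continuous_on_fst continuous_on_snd continuous_on_id)+
  have "continuous_on UNIV (\<lambda>p::bool \<times> (int \<Rightarrow> bool) \<times> real. case_nat (fst p) (fst (snd p) \<circ> e) n)" for n
    by (cases n) (simp_all add: coordinate continuous_on_fst continuous_on_id)
  then have "continuous_on UNIV (\<lambda>p::bool \<times> (int \<Rightarrow> bool) \<times> real. case_nat (fst p) (fst (snd p) \<circ> e))"
    by (rule continuous_on_coordinatewise_then_product)
  then have "continuous_on UNIV (\<lambda>p::bool \<times> (int \<Rightarrow> bool) \<times> real.
      (case_nat (fst p) (fst (snd p) \<circ> e), snd (snd p)))"
    by (rule continuous_on_Pair) (rule continuous_on_snd continuous_on_id)+
  then have "continuous_map (top_of_set cylinder) (top_of_set (UNIV \<times> {0..1}))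
      (\<lambda>p. (case_nat (fst p) (fst (snd p) \<circ> e), snd (snd p)))"
    by (auto simp: continuous_map_in_subtopology cylinder_def intro: continuous_on_subset)
  then have "continuous_map (top_of_set cylinder) mtopology
      (G \<circ> (\<lambda>p. (case_nat (fst p) (fst (snd p) \<circ> e), snd (snd p))))"
    using G_continuous continuous_map_compose by blast
  then show ?thesis
    by (rule continuous_map_eq) (auto simp: reading_def)
qed

lemma fan_map_factor:
  assumes "inj e" "0 \<in> range e" "\<And>n. e n + 1 \<in> range e"
  shows "fan_factor C d (reading e) (fan_map e)"
proof
  show "continuous_map (top_of_set cylinder) mtopology (reading e)"
    by (rule reading_continuous)
  show "reading e ` cylinder = C"
    using assms(1) by (rule reading_onto)
  fix p q assume pq: "p \<in> cylinder" "q \<in> cylinder" "reading e p = reading e q"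
  obtain b x t b' x' t' where [simp]: "p = (b, x, t)" "q = (b', x', t')"
    by (metis prod_cases3)
  show "snd (snd p) = snd (snd q)" "snd (snd p) > 0 \<Longrightarrow> fst p = fst q"
    using pq by (auto simp: reading_eq)
next
  fix p assume p: "p \<in> cylinder"
  define q where "q = inv_into cylinder (reading e) (reading e p)"
  have q: "q \<in> cylinder" "reading e q = reading e p"
    unfolding q_def using p by (auto intro: inv_into_into f_inv_into_f)
  obtain b x t b' x' t' where pq: "p = (b, x, t)" "q = (b', x', t')"
    by (metis prod_cases3)
  have eq: "t' = t" "t = 0 \<or> b' = b \<and> x' \<circ> e = x \<circ> e"
    using q p by (auto simp: pq reading_eq)
  have "x' i = x i" if "t \<noteq> 0" "i \<in> range e" for i
    using eq(2) that by (auto simp: fun_eq_iff)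
  then have "t \<noteq> 0 \<Longrightarrow> x' 0 = x 0" "t \<noteq> 0 \<Longrightarrow> (\<lambda>i. x' (i + 1)) \<circ> e = (\<lambda>i. x (i + 1)) \<circ> e"
    using assms(2,3) by (auto simp: fun_eq_iff)
  then have "reading e (model_step q) = reading e (model_step p)"
    using model_step_in_cylinder[OF p] model_step_in_cylinder[OF q(1)] eq
    by (cases "t = 0") (auto simp: pq model_step_def reading_eq)
  then show "fan_map e (reading e p) = reading e (model_step p)"
    by (simp add: fan_map_def q_def)
qed

lemma one_sided_fan_map_factor: "fan_factor C d (reading int) (fan_map int)"
proof (rule fan_map_factor)
  show "int n + 1 \<in> range int" for n
    by (rule image_eqI[of _ _ "Suc n"]) auto
qed auto

lemma two_sided_fan_map_factor: "bij e \<Longrightarrow> fan_factor C d (reading e) (fan_map e)"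
  by (intro fan_map_factor) (auto simp: bij_def)

text \<open>Two points of level \<open>1\<close> whose sequences differ only at position \<open>0\<close> have the same image.\<close>

lemma one_sided_fan_map_not_homeomorphic:
  "\<not> homeomorphic_map mtopology mtopology (fan_map int)"
proof
  assume "homeomorphic_map mtopology mtopology (fan_map int)"
  then have inj: "inj_on (fan_map int) C"
    by (simp add: homeomorphic_eq_everything_map)
  interpret fan_factor C d "reading int" "fan_map int"
    by (rule one_sided_fan_map_factor)
  define p q :: "bool \<times> (int \<Rightarrow> bool) \<times> real"
    where "p = (True, \<lambda>i. True, 1)" and "q = (True, \<lambda>i. i \<noteq> 0, 1)"
  have pq: "p \<in> cylinder" "q \<in> cylinder" by (auto simp: p_def q_def cylinder_def)
  have "reading int (model_step p) = reading int (model_step q)"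
    by (auto simp: p_def q_def model_step_def reading_def fun_eq_iff
        intro!: arg_cong[of _ _ G] split: nat.splits)
  then have "reading int p = reading int q"
    using inj_onD[OF inj] semiconjugacy pq Q_in by simp
  then show False
    using pq unfolding p_def q_def by (subst (asm) reading_eq) (auto simp: fun_eq_iff)
qed

text \<open>The model step is invertible: the symbol that was read is the one at position \<open>-1\<close> of the
  image, so it is known which of the two level maps to undo.\<close>

lemma two_sided_fan_map_homeomorphic:
  assumes "bij e"
  shows "homeomorphic_map mtopology mtopology (fan_map e)"
proof -
  interpret fan_factor C d "reading e" "fan_map e"
    using assms by (rule two_sided_fan_map_factor)
  have cancel: "x \<circ> e = x' \<circ> e \<longleftrightarrow> x = x'" for x x' :: "int \<Rightarrow> bool"
  proof
    assume eq: "x \<circ> e = x' \<circ> e"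
    have "x i = x' i" for i
      using fun_cong[OF eq, of "inv e i"] assms by (simp add: bij_is_surj surj_f_inv_f)
    then show "x = x'" by blast
  qed simp
  have shift: "(\<lambda>i. x (i + 1)) = (\<lambda>i. x' (i + 1)) \<longleftrightarrow> x = x'" for x x' :: "int \<Rightarrow> bool"
  proof
    assume eq: "(\<lambda>i. x (i + 1)) = (\<lambda>i. x' (i + 1))"
    have "x i = x' i" for i
      using fun_cong[OF eq, of "i - 1"] by simp
    then show "x = x'" by blast
  qed simp
  show ?thesis
  proof (rule continuous_imp_homeomorphic_map)
    show "continuous_map mtopology mtopology (fan_map e)" by (rule f_continuous)
    show "compact_space mtopology" by (rule compact_space_C)
    show "Hausdorff_space mtopology" by (rule Hausdorff_space_mtopology)
    have "z \<in> fan_map e ` C" if z: "z \<in> C" for z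
    proof -
      obtain b x t where p: "(b, x, t) \<in> cylinder" "z = reading e (b, x, t)"
        using z Q_onto by (metis imageE prod_cases3)
      define q where "q = (b, \<lambda>i. x (i - 1), if x (- 1) then t\<^sup>2 else sqrt t)"
      have t: "0 \<le> t" "t \<le> 1" using p(1) by (auto simp: cylinder_def)
      then have q: "q \<in> cylinder" by (auto simp: q_def cylinder_def power_le_one)
      have "model_step q = (b, x, t)"
        using t by (auto simp: q_def model_step_def)
      then show ?thesis
        using semiconjugacy[OF q] p(2) Q_in[OF q] by (metis image_eqI)
    qed
    moreover have "fan_map e z \<in> C" if "z \<in> C" for z
      using that Q_onto Q_in semiconjugacy model_step_in_cylinder by (metis imageE)
    ultimately show "fan_map e ` topspace mtopology = topspace mtopology" by auto
    show "inj_on (fan_map e) (topspace mtopology)"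
    proof (rule inj_onI)
      fix z z'
      assume "z \<in> topspace mtopology" and "z' \<in> topspace mtopology"
        and eq: "fan_map e z = fan_map e z'"
      then have "z \<in> reading e ` cylinder" and z': "z' \<in> reading e ` cylinder"
        by (simp_all add: Q_onto)
      then obtain b x t where p: "(b, x, t) \<in> cylinder" "z = reading e (b, x, t)"
        by (metis imageE prod_cases3)
      obtain b' x' t' where p': "(b', x', t') \<in> cylinder" "z' = reading e (b', x', t')"
        using z' by (metis imageE prod_cases3)
      have t: "0 \<le> t" "0 \<le> t'" using p p' by (auto simp: cylinder_def)
      define s s' where "s = (if x 0 then sqrt t else t\<^sup>2)" and "s' = (if x' 0 then sqrt t' else t'\<^sup>2)"
      have "reading e (b, \<lambda>i. x (i + 1), s) = reading e (b', \<lambda>i. x' (i + 1), s')"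
        using eq p p' semiconjugacy by (simp add: model_step_def s_def s'_def)
      moreover have "(b, \<lambda>i. x (i + 1), s) \<in> cylinder" "(b', \<lambda>i. x' (i + 1), s') \<in> cylinder"
        using p(1)[THEN model_step_in_cylinder] p'(1)[THEN model_step_in_cylinder] by (auto simp: model_step_def s_def s'_def)
      ultimately have "s = s'" "s = 0 \<or> b = b' \<and> x = x'"
        by (auto simp: reading_eq cancel shift)
      moreover have "s = 0 \<longleftrightarrow> t = 0" "s' = 0 \<longleftrightarrow> t' = 0"
        by (auto simp: s_def s'_def)
      moreover have "s = s' \<Longrightarrow> x = x' \<Longrightarrow> t = t'"
        using t by (auto simp: s_def s'_def split: if_splits)
      ultimately have "t = t'" "t = 0 \<or> b = b' \<and> x = x'" by auto
      then show "z = z'"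
        using p p' by (auto simp: reading_eq)
    qed
  qed
qed

end

section \<open>Cantor fans\<close>

text \<open>Every Cantor set in the line is parametrised by its addresses, and the branch of \<open>c\<close>
  is parametrised by the depth below the vertex.\<close>

lemma cantor_fan_coordinates:
  assumes "is_cantor_fan C d"
  obtains G where "fan_coordinates C d G"
proof -
  interpret Metric_space C d
    using assms by (simp add: is_cantor_fan_def continuum_def)
  obtain K where K: "K homeomorphic ternary_cantor_set" and fan: "mtopology homeomorphic_space top_of_set (fan_over K)"
    using assms by (auto simp: is_cantor_fan_def is_cantor_set_def)
  obtain h k where hk: "homeomorphism ternary_cantor_set K h k"
    using K homeomorphic_sym unfolding homeomorphic_def by blast
  obtain v u where "homeomorphic_maps mtopology (top_of_set (fan_over K)) v u"
    using fan unfolding homeomorphic_space_def by blast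
  then have u: "homeomorphic_map (top_of_set (fan_over K)) mtopology u"
    using homeomorphic_maps_sym homeomorphic_map_maps by blast
  define \<kappa> where "\<kappa> = h \<circ> ternary_point"
  have \<kappa>_cont: "continuous_on UNIV \<kappa>"
    unfolding \<kappa>_def using hk ternary_point_continuous
    by (intro continuous_on_compose) (simp_all add: range_ternary_point homeomorphism_def)
  have \<kappa>_range: "range \<kappa> = K"
    using hk unfolding \<kappa>_def by (metis homeomorphism_def image_comp range_ternary_point)
  have "inj_on h (range ternary_point)"
    using hk unfolding range_ternary_point homeomorphism_def by (metis inj_on_inverseI)
  then have \<kappa>_inj: "inj \<kappa>"
    unfolding \<kappa>_def using ternary_point_inj by (rule comp_inj_on[rotated])
  define F :: "(nat \<Rightarrow> bool) \<times> real \<Rightarrow> real \<times> real" where "F = (\<lambda>(c, t). (t * \<kappa> c, - t))"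
  have "continuous_on UNIV F"
  proof -
    have "continuous_on UNIV (\<lambda>p::(nat \<Rightarrow> bool) \<times> real. \<kappa> (fst p))"
      by (rule continuous_on_compose2[OF \<kappa>_cont continuous_on_fst]) (rule continuous_on_id, simp)
    then have "continuous_on UNIV (\<lambda>p. (snd p * \<kappa> (fst p), - snd p))"
      by (rule continuous_on_Pair[OF continuous_on_mult[OF continuous_on_snd[OF continuous_on_id]]
            continuous_on_minus[OF continuous_on_snd[OF continuous_on_id]]])
    then show ?thesis by (simp add: F_def case_prod_beta)
  qed
  moreover have F_image: "F ` (UNIV \<times> {0..1}) = fan_over K"
    unfolding \<kappa>_range[symmetric] fan_over_def closed_segment_def F_def by (force simp: image_iff)
  ultimately have F: "continuous_map (top_of_set (UNIV \<times> {0..1})) (top_of_set (fan_over K)) F"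
    by (auto simp: continuous_map_in_subtopology intro: continuous_on_subset)
  have "fan_coordinates C d (u \<circ> F)"
  proof
    show "continuous_map (top_of_set (UNIV \<times> {0..1})) mtopology (u \<circ> F)"
      using F u homeomorphic_imp_continuous_map continuous_map_compose by blast
    have u_image: "u ` fan_over K = C" and u_inj: "inj_on u (fan_over K)"
      using u by (simp_all add: homeomorphic_eq_everything_map)
    then show "(u \<circ> F) ` (UNIV \<times> {0..1}) = C"
      by (metis F_image image_comp)
    fix t t' :: real and c c' assume t: "t \<in> {0..1}" "t' \<in> {0..1}"
    then have "F (c, t) \<in> fan_over K" "F (c', t') \<in> fan_over K"
      unfolding F_image[symmetric] by auto
    then have "(u \<circ> F) (c, t) = (u \<circ> F) (c', t') \<longleftrightarrow> F (c, t) = F (c', t')"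
      using u_inj by (simp add: inj_on_eq_iff)
    also have "\<dots> \<longleftrightarrow> t = t' \<and> (t = 0 \<or> c = c')"
      using \<kappa>_inj by (auto simp: F_def inj_eq)
    finally show "(u \<circ> F) (c, t) = (u \<circ> F) (c', t') \<longleftrightarrow> t = t' \<and> (t = 0 \<or> c = c')" .
  qed
  then show thesis by (rule that)
qed

theorem theorem4p28:
  fixes C :: "'a set" and d :: "'a \<Rightarrow> 'a \<Rightarrow> real"
  assumes "is_cantor_fan C d"
  shows "(\<exists>f. dynamical_system C d f \<and>
            \<not> homeomorphic_map (Metric_space.mtopology C d) (Metric_space.mtopology C d) f \<and>
            knudsen_chaotic C d f \<and> \<not> devaney_chaotic C d f) \<and>
         (\<exists>h. dynamical_system C d h \<and>
            homeomorphic_map (Metric_space.mtopology C d) (Metric_space.mtopology C d) h \<and>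
            knudsen_chaotic C d h \<and> \<not> devaney_chaotic C d h)"
proof -
  obtain G where "fan_coordinates C d G"
    using cantor_fan_coordinates[OF assms] .
  then interpret fan_coordinates C d G .
  interpret one_sided: fan_factor C d "reading int" "fan_map int"
    by (rule one_sided_fan_map_factor)
  interpret two_sided: fan_factor C d "reading int_decode" "fan_map int_decode"
    by (rule two_sided_fan_map_factor[OF bij_int_decode])
  show ?thesis
    using one_sided.chaotic_in_Knudsen_not_Devaney_sense one_sided_fan_map_not_homeomorphic
      two_sided.chaotic_in_Knudsen_not_Devaney_sense
      two_sided_fan_map_homeomorphic[OF bij_int_decode]
    by blast
qed

end
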